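(* For each customer $k\in V_0$ with fixed routing decision $\boldsymbol{y}^k$, assuming that $\frac{a_w^k}{a_\ell^k}+\frac{a_w^k}{a_u^k}\le 1$, the optimal service time window $[\bar\ell^k,\bar u^k]$ of the problem $$\min_{\ell^k,u^k}\Big\{a_w^k(u^k-\ell^k)+a_\ell^k\,\mathbb{E}_{\mathrm P}\big[(\ell^k-\tau^k(\boldsymbol{y}^k,\tilde{\boldsymbol t}))^+\big]+a_u^k\,\mathbb{E}_{\mathrm P}\big[(\tau^k(\boldsymbol{y}^k,\tilde{\boldsymbol t})-u^k)^+\big]\;:\;0\le \ell^k\le u^k\Big\}$$ is given as $$\bar\ell^k=\max\Big\{\ell^k:\ \Pr\big(\ell^k\le \tau^k(\boldsymbol{y}^k,\tilde{\boldsymbol t})\le \bar u^k\big)\ge 1-\frac{a_w^k}{a_\ell^k}-\frac{a_w^k}{a_u^k}\Big\},$$ $$\bar u^k=\min\Big\{u^k:\ \Pr\big(\bar\ell^k\le \tau^k(\boldsymbol{y}^k,\tilde{\boldsymbol t})\le u^k\big)\ge 1-\frac{a_w^k}{a_\ell^k}-\frac{a_w^k}{a_u^k}\Big\}.$$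
   Context: $V_0=\{1,\dots,n\}$ is the set of customers, $0$ is the depot, $V=\{0,1,\dots,n\}$, and $A$ is the set of directed links between locations in $V$. The vector $\tilde{\boldsymbol t}=(\tilde t_{ij})_{(i,j)\in A}$ of random link travel times follows a continuous distribution $\mathrm P$ with continuous probability density function $p$; travel times are nonnegative and have finite mean. For customer $k$, the routing decision $\boldsymbol{y}^k=(y^k_{ij})_{(i,j)\in A}\in\{0,1\}^{|A|}$ describes the route from depot $0$ to customer $k$: $y^k_{ij}=1$ if and only if link $(i,j)$ is on that route. The random arrival time at $k$ is $\tau^k(\boldsymbol{y}^k,\tilde{\boldsymbol t})=\sum_{(i,j)\in A}y^k_{ij}\tilde t_{ij}$. A service time window for $k$ is an interval $[\ell^k,u^k]$. The penalty parameters $a_w^k,a_\ell^k,a_u^k\in(0,1]$ weight, respectively, the window length, the expected earliness and the expected tardiness at customer $k$. Notation: $(z)^+=\max\{z,0\}$. *)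

theory Defs
  imports "HOL-Probability.Probability"
begin

(* Locations are natural numbers, with 0 the depot; links are ordered pairs of locations. *)

definition links :: "nat list \<Rightarrow> (nat \<times> nat) set" where
  "links vs = set (zip vs (tl vs))"

definition route_to :: "(nat \<times> nat) set \<Rightarrow> nat \<Rightarrow> nat list \<Rightarrow> bool" where
  "route_to A k vs \<longleftrightarrow>
     vs \<noteq> [] \<and> hd vs = 0 \<and> last vs = k \<and> distinct vs \<and> links vs \<subseteq> A"

definition routing_decision :: "(nat \<times> nat) set \<Rightarrow> nat \<Rightarrow> (nat \<times> nat \<Rightarrow> real) \<Rightarrow> bool" where
  "routing_decision A k y \<longleftrightarrow>
     (\<forall>a\<in>A. y a \<in> {0, 1}) \<and>
     (\<exists>vs. route_to A k vs \<and> (\<forall>a\<in>A. y a = 1 \<longleftrightarrow> a \<in> links vs))"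

definition arrival_time ::
  "(nat \<times> nat) set \<Rightarrow> (nat \<times> nat \<Rightarrow> real) \<Rightarrow> (nat \<times> nat \<Rightarrow> real) \<Rightarrow> real" where
  "arrival_time A y t = (\<Sum>a\<in>A. y a * t a)"

(* Vectors indexed by A are functions that are undefined outside A, as in Pi_M A.
   Continuity of the density is only required on the nonnegative orthant, so that
   densities that jump at its boundary, such as the exponential one, are included. *)
definition travel_times ::
  "'w measure \<Rightarrow> (nat \<times> nat) set \<Rightarrow> ('w \<Rightarrow> nat \<times> nat \<Rightarrow> real) \<Rightarrow> ((nat \<times> nat \<Rightarrow> real) \<Rightarrow> real) \<Rightarrow> bool"
  where
  "travel_times M A t p \<longleftrightarrow>
     prob_space M \<and>
     distributed M (Pi\<^sub>M A (\<lambda>_. lborel)) t (\<lambda>x. ennreal (p x)) \<and>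
     (\<forall>x. 0 \<le> p x) \<and>
     continuous_on (Pi\<^sub>E A (\<lambda>_. {0..})) p \<and>
     (\<forall>a\<in>A. AE \<omega> in M. 0 \<le> t \<omega> a) \<and>
     (\<forall>a\<in>A. integrable M (\<lambda>\<omega>. t \<omega> a))"

(* The candidates for the maximal l and the minimal u range over windows too: if the
   probability bound is 0, every real l satisfies it, and only l <= u bounds it above. *)
definition time_window :: "real \<Rightarrow> real \<Rightarrow> bool" where
  "time_window l u \<longleftrightarrow> 0 \<le> l \<and> l \<le> u"

definition window_cost ::
  "'w measure \<Rightarrow> ('w \<Rightarrow> real) \<Rightarrow> real \<Rightarrow> real \<Rightarrow> real \<Rightarrow> real \<Rightarrow> real \<Rightarrow> real" where
  "window_cost M \<tau> aw al au l u =
     aw * (u - l)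
     + al * (\<integral>\<omega>. max (l - \<tau> \<omega>) 0 \<partial>M)
     + au * (\<integral>\<omega>. max (\<tau> \<omega> - u) 0 \<partial>M)"

definition optimal_window ::
  "'w measure \<Rightarrow> ('w \<Rightarrow> real) \<Rightarrow> real \<Rightarrow> real \<Rightarrow> real \<Rightarrow> real \<Rightarrow> real \<Rightarrow> bool" where
  "optimal_window M \<tau> aw al au l u \<longleftrightarrow>
     is_arg_min (\<lambda>(l, u). window_cost M \<tau> aw al au l u) (\<lambda>(l, u). time_window l u) (l, u)"

(* Library Max and Min are meant for finite sets; these also assert attainment. *)
definition is_maximum :: "real set \<Rightarrow> real \<Rightarrow> bool" where
  "is_maximum S m \<longleftrightarrow> m \<in> S \<and> (\<forall>x\<in>S. x \<le> m)"

definition is_minimum :: "real set \<Rightarrow> real \<Rightarrow> bool" where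
  "is_minimum S m \<longleftrightarrow> m \<in> S \<and> (\<forall>x\<in>S. m \<le> x)"

end

theory Submission
  imports Defs
begin

text \<open>The cost splits into a term in \<open>l\<close> alone and a term in \<open>u\<close> alone, each convex. At a point
where the distribution function of the arrival time equals \<open>aw / al\<close> the slope
\<open>- aw + al * P(\<tau> \<le> l)\<close> of the first term vanishes, and the second term is stationary where the
distribution function equals \<open>1 - aw / au\<close>. A subgradient inequality for expected earliness
turns stationarity into global optimality
(\<open>expected_earliness_subgradient\<close>, \<open>optimal_window_at_quantiles\<close>), and the condition on the
ratios is exactly what allows the two quantiles to be chosen in the order \<open>l \<le> u\<close>.
Since arrival times are nonnegative, a lower quantile at a positive level is nonnegative too, so the
constraints on windows do not interfere with the unconstrained minimum.

If the distribution function is continuous, the probability of a window is the difference of its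
values at the endpoints. With the upper endpoint at its quantile the bound on the
probability therefore says that the lower endpoint does not lie above its own quantile level, and
symmetrically. The distribution function may be flat at these levels, so the window of
the theorem is the narrowest optimal one: the largest lower quantile and the smallest upper
quantile. When the ratios add up to one the two levels coincide and the
narrowest choice is a window of length zero.

The distribution function is continuous because a route to a customer other than the depot uses
some link, and a hyperplane whose normal vector has a nonzero entry is a Lebesgue null set
(\<open>AE_lborel_PiM_linear_neq\<close>).\<close>

section \<open>Optimality of a window with quantile endpoints\<close>

text \<open>The function \<open>z \<mapsto> max (z - x) 0\<close> is convex with subgradient 1 at \<open>z \<ge> x\<close> and 0 at \<open>z < x\<close>; the
inequality is the expectation of the pointwise one.\<close>
lemma (in prob_space) expected_earliness_subgradient:
  fixes X :: "'a \<Rightarrow> real"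
  assumes X: "integrable M X"
  shows "expectation (\<lambda>\<omega>. max (l - X \<omega>) 0) + (l' - l) * \<P>(\<omega> in M. X \<omega> \<le> l)
    \<le> expectation (\<lambda>\<omega>. max (l' - X \<omega>) 0)"
proof -
  have [measurable]: "X \<in> borel_measurable M"
    using X by simp
  let ?I = "\<lambda>\<omega>. indicator {\<omega> \<in> space M. X \<omega> \<le> l} \<omega> :: real"
  have intI: "integrable M ?I"
    by (rule integrable_real_indicator) (auto simp: emeasure_eq_measure)
  have intl: "integrable M (\<lambda>\<omega>. max (z - X \<omega>) 0)" for z
    by (intro integrable_max Bochner_Integration.integrable_diff X) auto
  have "expectation (\<lambda>\<omega>. max (l - X \<omega>) 0) + (l' - l) * \<P>(\<omega> in M. X \<omega> \<le> l)
      = expectation (\<lambda>\<omega>. max (l - X \<omega>) 0 + (l' - l) * ?I \<omega>)"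
    using intI intl[of l] by (subst Bochner_Integration.integral_add) (auto simp: Int_absorb2)
  also have "\<dots> \<le> expectation (\<lambda>\<omega>. max (l' - X \<omega>) 0)"
  proof (rule integral_mono)
    show "integrable M (\<lambda>\<omega>. max (l - X \<omega>) 0 + (l' - l) * ?I \<omega>)"
      by (rule Bochner_Integration.integrable_add[OF intl integrable_mult_right[OF intI]])
    show "max (l - X \<omega>) 0 + (l' - l) * ?I \<omega> \<le> max (l' - X \<omega>) 0" if "\<omega> \<in> space M" for \<omega>
      using that by (cases "X \<omega> \<le> l") auto
  qed (rule intl)
  finally show ?thesis .
qed

text \<open>Tardiness of \<open>X\<close> after \<open>u\<close> is earliness of \<open>- X\<close> before \<open>- u\<close>.\<close>
lemma (in prob_space) expected_tardiness_subgradient: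
  fixes X :: "'a \<Rightarrow> real"
  assumes "integrable M X"
  shows "expectation (\<lambda>\<omega>. max (X \<omega> - u) 0) + (u - u') * \<P>(\<omega> in M. u \<le> X \<omega>)
    \<le> expectation (\<lambda>\<omega>. max (X \<omega> - u') 0)"
  using expected_earliness_subgradient[of "\<lambda>\<omega>. - X \<omega>" "- u" "- u'"] assms by simp

lemma (in prob_space) optimal_window_at_quantiles:
  fixes X :: "'a \<Rightarrow> real"
  assumes X: "integrable M X"
    and pos: "0 < al" "0 < au"
    and window: "time_window l u"
    and l: "\<P>(\<omega> in M. X \<omega> \<le> l) = aw / al"
    and u: "\<P>(\<omega> in M. u \<le> X \<omega>) = aw / au"
  shows "optimal_window M X aw al au l u"
proof -
  have "window_cost M X aw al au l u \<le> window_cost M X aw al au l' u'" for l' u'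
  proof -
    have "al * (expectation (\<lambda>\<omega>. max (l - X \<omega>) 0) + (l' - l) * (aw / al))
        \<le> al * expectation (\<lambda>\<omega>. max (l' - X \<omega>) 0)"
      using expected_earliness_subgradient[OF X, of l l'] l pos by (intro mult_left_mono) auto
    moreover have "au * (expectation (\<lambda>\<omega>. max (X \<omega> - u) 0) + (u - u') * (aw / au))
        \<le> au * expectation (\<lambda>\<omega>. max (X \<omega> - u') 0)"
      using expected_tardiness_subgradient[OF X, of u u'] u pos by (intro mult_left_mono) auto
    moreover have "al * ((l' - l) * (aw / al)) = aw * (l' - l)"
      "au * ((u - u') * (aw / au)) = aw * (u - u')"
      using pos by simp_all
    ultimately show ?thesis
      unfolding window_cost_def distrib_left by (simp add: right_diff_distrib)
  qed
  then show ?thesis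
    using window by (auto simp: optimal_window_def is_arg_min_linorder)
qed

section \<open>Windows of an atomless nonnegative arrival time\<close>

lemma (in real_distribution) cdf_level_set_nonempty_compact:
  assumes cont: "\<And>x. isCont (cdf M) x" and q: "0 < q" "q < 1"
  shows "{x. cdf M x = q} \<noteq> {}" "compact {x. cdf M x = q}"
proof -
  obtain a where a: "\<And>x. x \<le> a \<Longrightarrow> cdf M x < q"
    using order_tendstoD(2)[OF cdf_lim_at_bot q(1)] by (auto simp: eventually_at_bot_linorder)
  obtain b where b: "\<And>x. b \<le> x \<Longrightarrow> q < cdf M x"
    using order_tendstoD(1)[OF cdf_lim_at_top_prob q(2)] by (auto simp: eventually_at_top_linorder)
  have "a \<le> b"
    using a[of a] b[of a] by linarith
  then obtain x where "cdf M x = q"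
    using IVT[of "cdf M" a q b] a[of a] b[of b] cont by auto
  then show "{x. cdf M x = q} \<noteq> {}"
    by auto
  have "x \<in> {a..b}" if "cdf M x = q" for x
    using that a[of x] b[of x] by (cases "x \<le> a"; cases "b \<le> x") auto
  then have "{x. cdf M x = q} \<subseteq> {a..b}"
    by blast
  moreover have "closed {x. cdf M x = q}"
    using cont by (intro closed_Collect_eq) (auto simp: continuous_on_eq_continuous_at)
  ultimately show "compact {x. cdf M x = q}"
    by (meson bounded_closed_interval bounded_subset compact_eq_bounded_closed)
qed

text \<open>The maximum and the minimum are taken over windows of prescribed probability, which for an
atomless \<open>X\<close> are governed by the values of the distribution function at the endpoints.\<close>
lemma (in prob_space) optimal_window_extremal:
  fixes X :: "'a \<Rightarrow> real"
  assumes X: "integrable M X"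
    and nonneg: "AE \<omega> in M. 0 \<le> X \<omega>"
    and atomless: "\<And>c. AE \<omega> in M. X \<omega> \<noteq> c"
    and pos: "0 < aw" "0 < al" "0 < au"
    and ratio: "aw / al + aw / au \<le> 1"
  shows "\<exists>l u. optimal_window M X aw al au l u \<and>
    is_maximum {l'. time_window l' u \<and>
      \<P>(\<omega> in M. l' \<le> X \<omega> \<and> X \<omega> \<le> u) \<ge> 1 - aw / al - aw / au} l \<and>
    is_minimum {u'. time_window l u' \<and>
      \<P>(\<omega> in M. l \<le> X \<omega> \<and> X \<omega> \<le> u') \<ge> 1 - aw / al - aw / au} u"
proof -
  have [measurable]: "X \<in> borel_measurable M"
    using X by simp
  define F where "F = cdf (distr M borel X)"
  interpret D: real_distribution "distr M borel X"
    by simp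
  have F: "\<P>(\<omega> in M. X \<omega> \<le> x) = F x" for x
    by (simp add: F_def cdf_def measure_distr vimage_def Int_def conj_commute)
  have mono: "F x \<le> F x'" if "x \<le> x'" for x x'
    using that unfolding F_def by (rule D.cdf_nondecreasing)
  have cont: "isCont F x" for x
  proof -
    have "measure (distr M borel X) {x} = \<P>(\<omega> in M. X \<omega> = x)"
      by (simp add: measure_distr vimage_def Int_def conj_commute)
    also have "\<dots> = 0"
      using atomless[of x] by (subst prob_eq_0) auto
    finally show ?thesis
      unfolding F_def D.isCont_cdf .
  qed
  have interval: "\<P>(\<omega> in M. x \<le> X \<omega> \<and> X \<omega> \<le> x') = F x' - F x" if "x \<le> x'" for x x'
  proof -
    have "\<P>(\<omega> in M. x \<le> X \<omega> \<and> X \<omega> \<le> x')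
        = prob ({\<omega> \<in> space M. X \<omega> \<le> x'} - {\<omega> \<in> space M. X \<omega> \<le> x})"
      using atomless[of x] by (intro finite_measure_eq_AE) auto
    also have "\<dots> = F x' - F x"
      using that by (subst finite_measure_Diff) (auto simp: F)
    finally show ?thesis .
  qed
  have upper: "\<P>(\<omega> in M. x \<le> X \<omega>) = 1 - F x" for x
  proof -
    have "\<P>(\<omega> in M. x \<le> X \<omega>) = prob (space M - {\<omega> \<in> space M. X \<omega> \<le> x})"
      using atomless[of x] by (intro finite_measure_eq_AE) auto
    also have "\<dots> = 1 - F x"
      by (subst prob_compl) (auto simp: F)
    finally show ?thesis .
  qed
  have nonneg_point: "0 \<le> x" if "0 < F x" for x
  proof (rule ccontr)
    assume "\<not> 0 \<le> x"
    then have "AE \<omega> in M. \<not> X \<omega> \<le> x"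
      using nonneg by auto
    then have "F x = 0"
      by (subst F[symmetric], subst prob_eq_0) auto
    with that show False by simp
  qed
  define r where "r = aw / al"
  define s where "s = aw / au"
  have rs: "0 < r" "0 < s" "r + s \<le> 1"
    using pos ratio by (auto simp: r_def s_def)
  have optimal: "optimal_window M X aw al au l u" if "l \<le> u" "F l = r" "F u = 1 - s" for l u
    using that rs nonneg_point[of l] pos
    by (intro optimal_window_at_quantiles[OF X]) (auto simp: time_window_def F upper r_def s_def)
  show ?thesis
  proof (cases "r + s = 1")
    case True
    obtain m where m: "F m = r"
      using D.cdf_level_set_nonempty_compact(1)[of r] cont rs unfolding F_def by auto
    then have "0 \<le> m"
      using nonneg_point rs by auto
    \<comment> \<open>Every window meets the probability bound, so only the order of the endpoints constrains.\<close>
    have bound: "1 - aw / al - aw / au = 0"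
      using True by (simp add: r_def s_def)
    from m \<open>0 \<le> m\<close> True show ?thesis
      unfolding bound
      by (intro exI[of _ m] conjI optimal) (auto simp: is_maximum_def is_minimum_def time_window_def)
  next
    case False
    obtain l where l: "F l = r" and l_max: "\<And>x. F x = r \<Longrightarrow> x \<le> l"
      using D.cdf_level_set_nonempty_compact[of r] cont rs compact_attains_sup[of "{x. F x = r}"]
      unfolding F_def by auto
    obtain u where u: "F u = 1 - s" and u_min: "\<And>x. F x = 1 - s \<Longrightarrow> u \<le> x"
      using D.cdf_level_set_nonempty_compact[of "1 - s"] cont rs
        compact_attains_inf[of "{x. F x = 1 - s}"]
      unfolding F_def by auto
    have "l \<le> u"
      using mono[of u l] l u False rs by linarith
    have "0 \<le> l"
      using nonneg_point l rs by auto
    have "x \<le> l" if "x \<le> u" "1 - r - s \<le> F u - F x" for x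
      using that u l l_max[of x] mono[of l x] by linarith
    moreover have "u \<le> x" if "l \<le> x" "1 - r - s \<le> F x - F l" for x
      using that u l u_min[of x] mono[of x u] by linarith
    ultimately show ?thesis
      using l u \<open>l \<le> u\<close> \<open>0 \<le> l\<close> unfolding r_def[symmetric] s_def[symmetric]
      by (intro exI[of _ l] exI[of _ u] conjI optimal)
        (auto simp: is_maximum_def is_minimum_def time_window_def interval)
  qed
qed

section \<open>Continuity of the arrival time distribution\<close>

text \<open>Once all coordinates but \<open>b\<close> are fixed, the equation determines the remaining one; by Fubini
the hyperplane is null.\<close>
lemma AE_lborel_PiM_linear_neq:
  fixes c :: "'i \<Rightarrow> real"
  assumes A: "finite A" "b \<in> A" and b: "c b \<noteq> 0"
  shows "AE x in Pi\<^sub>M A (\<lambda>_. lborel). (\<Sum>a\<in>A. c a * x a) \<noteq> z"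
proof -
  interpret product_sigma_finite "\<lambda>_::'i. lborel :: real measure"
    by standard
  define B where "B = A - {b}"
  have AB: "A = insert b B" and B: "finite B" "b \<notin> B"
    using A by (auto simp: B_def)
  let ?N = "Pi\<^sub>M (insert b B) (\<lambda>_. lborel :: real measure)"
  let ?S = "{x \<in> space ?N. (\<Sum>a\<in>insert b B. c a * x a) = z}"
  have S: "?S \<in> sets ?N"
    by measurable
  have "emeasure ?N ?S = (\<integral>\<^sup>+x. indicator ?S x \<partial>?N)"
    using S by simp
  also have "\<dots> = (\<integral>\<^sup>+x. (\<integral>\<^sup>+s. indicator ?S (x(b := s)) \<partial>lborel) \<partial>Pi\<^sub>M B (\<lambda>_. lborel))"
    using B S by (intro product_nn_integral_insert) auto
  also have "\<dots> = (\<integral>\<^sup>+x. 0 \<partial>Pi\<^sub>M B (\<lambda>_. lborel :: real measure))"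
  proof (intro nn_integral_cong)
    fix x :: "'i \<Rightarrow> real"
    have "(\<integral>\<^sup>+s. indicator ?S (x(b := s)) \<partial>lborel)
        \<le> (\<integral>\<^sup>+s. indicator {(z - (\<Sum>a\<in>B. c a * x a)) / c b} s \<partial>(lborel :: real measure))"
    proof (intro nn_integral_mono)
      fix s :: real
      have "(\<Sum>a\<in>B. c a * (x(b := s)) a) = (\<Sum>a\<in>B. c a * x a)"
        using B by (intro sum.cong) auto
      then show "indicator ?S (x(b := s))
          \<le> (indicator {(z - (\<Sum>a\<in>B. c a * x a)) / c b} s :: ennreal)"
        using B b by (auto simp: indicator_def field_simps)
    qed
    then show "(\<integral>\<^sup>+s. indicator ?S (x(b := s)) \<partial>lborel) = 0"
      by simp
  qed
  finally have "emeasure ?N ?S = 0"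
    by simp
  then show ?thesis
    unfolding AB using S by (intro AE_I[of _ _ ?S]) auto
qed

lemma distributed_AE:
  assumes X: "distributed M N X f" and P: "AE x in N. P x"
  shows "AE \<omega> in M. P (X \<omega>)"
proof -
  have "absolutely_continuous N (distr M N X)"
    using X by (simp add: distributed_def absolutely_continuousI_density)
  then have "AE x in distr M N X. P x"
    using P by (rule absolutely_continuous_AE[rotated]) simp
  moreover have "X \<in> measurable M N"
    using X by (simp add: distributed_def)
  ultimately show ?thesis
    by (rule AE_distrD[rotated])
qed

text \<open>A walk that starts at the depot and ends elsewhere visits at least two locations.\<close>
lemma routing_decision_uses_link:
  assumes "routing_decision A k y" and "k \<noteq> 0"
  obtains a where "a \<in> A" "y a = 1"
proof -
  obtain vs where vs: "route_to A k vs" and y: "\<forall>a\<in>A. y a = 1 \<longleftrightarrow> a \<in> links vs"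
    using assms(1) by (auto simp: routing_decision_def)
  obtain v w ws where "vs = v # w # ws"
    using vs \<open>k \<noteq> 0\<close> by (cases vs; cases "tl vs") (auto simp: route_to_def)
  then have "(v, w) \<in> links vs"
    by (simp add: links_def)
  moreover from this vs have "(v, w) \<in> A"
    by (auto simp: route_to_def)
  ultimately show ?thesis
    using y that by blast
qed

theorem proposition2:
  fixes n k :: nat
    and A :: "(nat \<times> nat) set"
    and M :: "'w measure"
    and t :: "'w \<Rightarrow> nat \<times> nat \<Rightarrow> real"
    and p :: "(nat \<times> nat \<Rightarrow> real) \<Rightarrow> real"
    and y :: "nat \<Rightarrow> nat \<times> nat \<Rightarrow> real"
    and aw al au :: "nat \<Rightarrow> real"
  defines "\<tau> \<equiv> \<lambda>k \<omega>. arrival_time A (y k) (t \<omega>)"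
  assumes links_A: "A \<subseteq> {0..n} \<times> {0..n}"
    and times: "travel_times M A t p"
    and customer: "k \<in> {1..n}"
    and routing: "routing_decision A k (y k)"
    and weights: "aw k \<in> {0<..1}" "al k \<in> {0<..1}" "au k \<in> {0<..1}"
    and ratio: "aw k / al k + aw k / au k \<le> 1"
  shows "\<exists>lbar ubar.
    optimal_window M (\<tau> k) (aw k) (al k) (au k) lbar ubar \<and>
    is_maximum {l. time_window l ubar \<and>
      \<P>(\<omega> in M. l \<le> \<tau> k \<omega> \<and> \<tau> k \<omega> \<le> ubar) \<ge> 1 - aw k / al k - aw k / au k} lbar \<and>
    is_minimum {u. time_window lbar u \<and>
      \<P>(\<omega> in M. lbar \<le> \<tau> k \<omega> \<and> \<tau> k \<omega> \<le> u) \<ge> 1 - aw k / al k - aw k / au k} ubar"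
proof -
  interpret prob_space M
    using times by (simp add: travel_times_def)
  have A: "finite A"
    using links_A by (rule finite_subset) simp
  have dist: "distributed M (Pi\<^sub>M A (\<lambda>_. lborel)) t (\<lambda>x. ennreal (p x))"
    and t_nonneg: "AE \<omega> in M. \<forall>a\<in>A. 0 \<le> t \<omega> a"
    and t_int: "\<And>a. a \<in> A \<Longrightarrow> integrable M (\<lambda>\<omega>. t \<omega> a)"
    using times A by (auto simp: travel_times_def AE_finite_all)
  have y_nonneg: "0 \<le> y k a" if "a \<in> A" for a
    using routing that by (force simp: routing_decision_def)
  have "integrable M (\<tau> k)"
    unfolding \<tau>_def arrival_time_def using t_int by (intro Bochner_Integration.integrable_sum) auto
  moreover have "AE \<omega> in M. 0 \<le> \<tau> k \<omega>"
    using t_nonneg unfolding \<tau>_def arrival_time_def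
    by eventually_elim (auto intro!: sum_nonneg mult_nonneg_nonneg y_nonneg)
  moreover have "AE \<omega> in M. \<tau> k \<omega> \<noteq> c" for c
  proof -
    obtain b where "b \<in> A" "y k b = 1"
      using routing_decision_uses_link[OF routing] customer by auto
    then show ?thesis
      unfolding \<tau>_def arrival_time_def using A
      by (intro distributed_AE[OF dist] AE_lborel_PiM_linear_neq) auto
  qed
  ultimately show ?thesis
    using weights ratio by (intro optimal_window_extremal) auto
qed

end
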